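(* Let $\beta\ge 0$. The following three conditions are equivalent: (i) $|E_{2,\beta}(z)|\ge E_{2,\beta}(\Re z)$ for all $z\in\mathbb{C}$; (ii) $E_{2,\beta}$ has only negative zeros; (iii) $\beta\le 3$.
   Context: For $\beta\in\mathbb{R}$, $E_{2,\beta}$ is the Mittag-Leffler function $E_{2,\beta}(z)=\sum_{k=0}^{\infty}\frac{z^k}{\Gamma(2k+\beta)}$, $z\in\mathbb{C}$, with the convention $1/\Gamma(s)=0$ at the poles $s=0,-1,-2,\dots$ of $\Gamma$. $\Re z$ denotes the real part of $z$. "Only negative zeros" means that every zero of $E_{2,\beta}$ in $\mathbb{C}$ is real and negative.
   Formalization: For β = 0 the origin is a zero of E_{2,0}, since 1/Γ(0) = 0, so (ii) as stated fails although β ≤ 3; condition (ii) is therefore read as allowing the zero z = 0 when β = 0. For β > 0 nothing is changed. *)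

theory Defs
  imports "HOL-Analysis.Analysis"
begin

(* rGamma is the entire function 1 / Gamma, so the terms at poles of Gamma vanish. *)
definition mittag_leffler :: "real \<Rightarrow> real \<Rightarrow> complex \<Rightarrow> complex" where
  "mittag_leffler \<alpha> \<beta> z =
     (\<Sum>k. z ^ k * rGamma (complex_of_real (\<alpha> * real k + \<beta>)))"

lemma summable_mittag_leffler_2:
  fixes z :: complex and \<beta> :: real
  shows "summable (\<lambda>k. z ^ k * rGamma (complex_of_real (2 * real k + \<beta>)))"
proof -
  obtain N :: nat where N: "real N \<ge> \<bar>\<beta>\<bar> + 2 * norm z + 1"
    using real_arch_simple by blast
  show ?thesis
  proof (rule summable_ratio_test[of "1/2" N])
    fix n :: nat assume n: "n \<ge> N"
    define x where "x = 2 * real n + \<beta>"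
    have "real n \<ge> real N" using n by simp
    hence x: "x \<ge> 1" "x \<ge> 2 * norm z"
      using N norm_ge_zero[of z] abs_ge_minus_self[of \<beta>] unfolding x_def by linarith+
    have "rGamma x = x * (x + 1) * rGamma (x + 2)"
      using rGamma_plus1[of x] rGamma_plus1[of "x + 1"] by (simp add: add.assoc mult.assoc)
    hence "\<bar>rGamma x\<bar> = x * (x + 1) * \<bar>rGamma (x + 2)\<bar>"
      using x(1) by (simp add: abs_mult)
    moreover have "2 * norm z \<le> x * (x + 1)"
      using x mult_mono[of 1 "x + 1" "2 * norm z" x] by (simp add: mult.commute)
    ultimately have "2 * norm z * \<bar>rGamma (x + 2)\<bar> \<le> \<bar>rGamma x\<bar>"
      by (metis abs_ge_zero mult_right_mono)
    hence "norm z ^ n * (2 * norm z * \<bar>rGamma (x + 2)\<bar>) \<le> norm z ^ n * \<bar>rGamma x\<bar>"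
      by (intro mult_left_mono) auto
    moreover have "2 * real (Suc n) + \<beta> = x + 2" by (simp add: x_def)
    ultimately show "norm (z ^ Suc n * rGamma (complex_of_real (2 * real (Suc n) + \<beta>)))
        \<le> 1/2 * norm (z ^ n * rGamma (complex_of_real (2 * real n + \<beta>)))"
      unfolding rGamma_complex_of_real x_def[symmetric]
      by (simp only: norm_mult norm_power norm_of_real power_Suc) (simp add: mult_ac)
  qed auto
qed

(* Hence taking Re of a value on the real line loses nothing. *)
lemma mittag_leffler_2_of_real:
  "mittag_leffler 2 \<beta> (complex_of_real x) =
     complex_of_real (Re (mittag_leffler 2 \<beta> (complex_of_real x)))"
proof -
  have "(\<lambda>k. Im (complex_of_real x ^ k * rGamma (complex_of_real (2 * real k + \<beta>))))
      sums Im (mittag_leffler 2 \<beta> (complex_of_real x))"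
    unfolding mittag_leffler_def
    by (intro sums_Im summable_sums summable_mittag_leffler_2)
  moreover have "Im (complex_of_real x ^ k * rGamma (complex_of_real (2 * real k + \<beta>))) = 0" for k
    unfolding rGamma_complex_of_real by (simp flip: of_real_power of_real_mult)
  ultimately have "(\<lambda>k. 0) sums Im (mittag_leffler 2 \<beta> (complex_of_real x))"
    by (simp only:)
  hence "Im (mittag_leffler 2 \<beta> (complex_of_real x)) = 0"
    using sums_unique2[OF sums_zero] by metis
  thus ?thesis by (simp add: complex_eq_iff)
qed

lemma mittag_leffler_at_0: "mittag_leffler \<alpha> \<beta> 0 = rGamma (complex_of_real \<beta>)"
  unfolding mittag_leffler_def by (subst suminf_finite[of "{0}"]) auto

(* The only case with \<beta> \<ge> 0 in which the origin is a zero. *)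
lemma mittag_leffler_2_0_at_0: "mittag_leffler 2 0 0 = 0"
  by (simp add: mittag_leffler_at_0)

end

theory Submission
  imports
    Defs
    "HOL-Complex_Analysis.Complex_Analysis"
    "HOL-Computational_Algebra.Fundamental_Theorem_Algebra"
    "HOL-Real_Asymp.Real_Asymp"
begin

text \<open>
  Write \<open>E\<close> for \<open>E\<^sub>2\<^sub>,\<^sub>\<beta>\<close>.

  For \<open>2 \<le> \<beta> \<le> 3\<close>, \<open>E\<close> is a pointwise limit of rescaled polynomials \<open>q\<^sub>n\<close> with generating function
  \<open>\<Sum> q\<^sub>n(u) x^n = (1 - x) powr (2 - \<beta>) / ((1 - x)\<^sup>2 - u x)\<close>. Substituting \<open>u = w + 1/w - 2\<close> turns
  \<open>q\<^sub>n\<close> into a sine polynomial with monotone coefficients, and the Enestrom--Kakeya theorem shows that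
  its zeros lie on the unit circle, that is, \<open>u \<in> [-4, 0]\<close>. The operator \<open>p \<mapsto> \<beta> p + 2 z p'\<close> preserves
  polynomials with nonpositive zeros and takes \<open>E\<^sub>2\<^sub>,\<^sub>\<beta>\<^sub>+\<^sub>1\<close> to \<open>E\<^sub>2\<^sub>,\<^sub>\<beta>\<close>, which extends the approximation
  to \<open>0 \<le> \<beta> \<le> 3\<close>. For a polynomial with real zeros, \<open>norm (p (x + i y))\<close> increases with \<open>\<bar>y\<bar>\<close>. This
  survives the limit, and gives the inequality as well as, by the identity theorem, the absence of
  nonreal zeros.

  For \<open>\<beta> > 3\<close>, \<open>E\<close> is positive on the real line, since \<open>E(-w\<^sup>2)\<close> is an integral of
  \<open>(1 - t) powr (\<beta> - 4) * (1 - cos (w t))\<close>. It has a zero nevertheless, because it is a nonconstant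
  entire function of order at most \<open>1/2\<close>. So both conditions fail.
\<close>

section \<open>Sine polynomials with monotone coefficients\<close>

text \<open>Multiplying by \<open>1 - w\<close> telescopes the sum into \<open>c 0 - w * S\<close>.
  The coefficients of \<open>S\<close> are nonnegative with total \<open>c 0\<close>, so a zero
  would give \<open>c 0 \<le> norm w * c 0\<close>.\<close>

lemma enestrom_kakeya:
  fixes c :: "nat \<Rightarrow> real" and w :: complex
  assumes dec: "\<And>m. m < n \<Longrightarrow> c (Suc m) \<le> c m" and "c n \<ge> 0" "c 0 > 0" "norm w < 1"
  shows "(\<Sum>m\<le>n. of_real (c m) * w ^ m) \<noteq> 0"
proof
  assume 0: "(\<Sum>m\<le>n. of_real (c m) * w ^ m) = 0"
  define S where "S = (\<Sum>m<n. of_real (c m - c (Suc m)) * w ^ m) + of_real (c n) * w ^ n"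
  have "(1 - w) * (\<Sum>m\<le>n. of_real (c m) * w ^ m) = of_real (c 0) - w * S"
    unfolding S_def
  proof (induction n)
    case (Suc n)
    show ?case
      unfolding sum.atMost_Suc ring_distribs(1) Suc sum.lessThan_Suc
      by (simp add: algebra_simps)
  qed (simp add: algebra_simps)
  hence c0: "c 0 = norm w * norm S"
  proof -
    have "of_real (c 0) = w * S" using \<open>(1 - w) * _ = _\<close> 0 by simp
    hence "norm (complex_of_real (c 0)) = norm (w * S)" by (rule arg_cong)
    thus ?thesis using assms(3) by (simp add: norm_mult)
  qed
  have "norm S \<le> (\<Sum>m<n. norm (of_real (c m - c (Suc m)) * w ^ m)) + norm (of_real (c n) * w ^ n)"
    unfolding S_def by (intro order.trans[OF norm_triangle_ineq] add_mono norm_sum order.refl)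
  also have "\<dots> \<le> (\<Sum>m<n. c m - c (Suc m)) + c n"
  proof (intro add_mono sum_mono)
    have 1: "norm w ^ m \<le> 1" for m
      using assms(4) by (simp add: power_le_one)
    show "norm (of_real (c n) * w ^ n) \<le> c n"
      using 1[of n] assms(2) by (simp add: norm_mult norm_power mult_left_le)
    show "norm (of_real (c m - c (Suc m)) * w ^ m) \<le> c m - c (Suc m)" if "m \<in> {..<n}" for m
      using 1[of m] dec[of m] that
      by (simp add: norm_mult norm_power mult_left_le del: of_real_diff)
  qed
  also have "(\<Sum>m<n. c m - c (Suc m)) = c 0 - c n"
    by (rule sum_lessThan_telescope')
  finally have "c 0 \<le> norm w * c 0"
    unfolding c0 by (intro mult_left_mono) auto
  with assms(3,4) show False
    by (metis mult_less_cancel_right2 not_less)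
qed

text \<open>\<open>1 / cnj w\<close> is the mirror image of \<open>w\<close> in the unit circle.
  Scaled by \<open>norm w\<close>, its distance to a point outside the open disc is at most that of
  \<open>w\<close>, so the bound holds factor by factor.\<close>

lemma prod_mset_reflection_le:
  fixes A :: "complex multiset"
  assumes "\<And>x. x \<in># A \<Longrightarrow> norm x \<ge> 1" and w: "norm w \<le> 1" "w \<noteq> 0"
  shows "norm w ^ size A * norm (poly (\<Prod>x\<in>#A. [:-x, 1:]) (1 / cnj w))
           \<le> norm (poly (\<Prod>x\<in>#A. [:-x, 1:]) w)"
  using assms(1)
proof (induction A)
  case (add x A)
  have x: "norm x \<ge> 1" using add.prems by simp
  have "norm w * norm (1 / cnj w - x) = norm (1 - cnj w * x)"
  proof -
    have "1 - cnj w * x = cnj w * (1 / cnj w - x)" using w by (simp add: field_simps)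
    thus ?thesis by (metis complex_mod_cnj norm_mult)
  qed
  also have "\<dots> \<le> norm (w - x)"
  proof (rule power2_le_imp_le)
    have "(norm (w - x))\<^sup>2 - (norm (1 - cnj w * x))\<^sup>2 = (1 - (norm w)\<^sup>2) * ((norm x)\<^sup>2 - 1)"
      by (simp add: cmod_power2) (simp add: power2_eq_square algebra_simps)
    moreover have "\<dots> \<ge> 0"
      using x w by (intro mult_nonneg_nonneg) (auto simp: power_le_one)
    ultimately show "(norm (1 - cnj w * x))\<^sup>2 \<le> (norm (w - x))\<^sup>2" by linarith
  qed auto
  finally have 1: "norm w * norm (1 / cnj w - x) \<le> norm (w - x)" .
  have "(norm w * norm (1 / cnj w - x)) *
          (norm w ^ size A * norm (poly (\<Prod>x\<in>#A. [:-x, 1:]) (1 / cnj w)))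
        \<le> norm (w - x) * norm (poly (\<Prod>x\<in>#A. [:-x, 1:]) w)"
    using add.IH add.prems by (intro mult_mono 1) auto
  moreover have "poly (\<Prod>x\<in>#add_mset x A. [:-x, 1:]) z = (z - x) * poly (\<Prod>x\<in>#A. [:-x, 1:]) z" for z
    by (simp add: algebra_simps)
  ultimately show ?case by (simp only: size_add_mset power_Suc norm_mult mult_ac)
qed auto

lemma poly_reflection_le:
  fixes p :: "complex poly"
  assumes roots: "\<And>z. poly p z = 0 \<Longrightarrow> norm z \<ge> 1"
    and w: "norm w \<le> 1" "w \<noteq> 0" and n: "degree p \<le> n"
  shows "norm w ^ n * norm (poly p (1 / cnj w)) \<le> norm (poly p w)"
proof (cases "p = 0")
  case False
  obtain A where A: "size A = degree p" "p = smult (lead_coeff p) (\<Prod>x\<in>#A. [:-x, 1:])"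
    using alg_closed_imp_factorization[OF False] by blast
  have "norm x \<ge> 1" if "x \<in># A" for x
  proof (rule roots)
    show "poly p x = 0"
      by (subst A(2)) (use that in \<open>auto simp: poly_prod_mset prod_mset_zero_iff\<close>)
  qed
  hence "norm w ^ size A * norm (poly (\<Prod>x\<in>#A. [:-x, 1:]) (1 / cnj w))
           \<le> norm (poly (\<Prod>x\<in>#A. [:-x, 1:]) w)"
    by (rule prod_mset_reflection_le[OF _ w])
  hence "norm (lead_coeff p) * (norm w ^ size A * norm (poly (\<Prod>x\<in>#A. [:-x, 1:]) (1 / cnj w)))
           \<le> norm (lead_coeff p) * norm (poly (\<Prod>x\<in>#A. [:-x, 1:]) w)"
    by (intro mult_left_mono) auto
  moreover have "norm (poly p z) = norm (lead_coeff p) * norm (poly (\<Prod>x\<in>#A. [:-x, 1:]) z)" for z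
    by (subst A(2)) (simp add: norm_mult)
  ultimately have "norm w ^ degree p * norm (poly p (1 / cnj w)) \<le> norm (poly p w)"
    by (simp add: A(1) mult_ac)
  \<comment> \<open>\<open>n\<close> may exceed the degree: in the application with
    \<open>\<beta> = 2\<close>, all coefficients after the first vanish.\<close>
  moreover have "norm w ^ n \<le> norm w ^ degree p"
    using w n by (intro power_decreasing) auto
  ultimately show ?thesis
    by (meson mult_right_mono norm_ge_zero order_trans)
qed auto

text \<open>
  If \<open>p\<close> has coefficients \<open>c\<close>, the sum is \<open>p(w) - w^(2 n + 2) * p(1/w)\<close>, and the reflection bound makes the
  second term the smaller one.
\<close>
lemma antipalindromic_sum_nonzero:
  fixes c :: "nat \<Rightarrow> real" and w :: complex
  assumes c: "\<And>m. m < n \<Longrightarrow> c (Suc m) \<le> c m" "c n \<ge> 0" "c 0 > 0"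
    and w: "norm w < 1" "w \<noteq> 0"
  shows "(\<Sum>m\<le>n. of_real (c m) * (w ^ m - w ^ (2 * n + 2 - m))) \<noteq> 0"
proof
  assume "(\<Sum>m\<le>n. of_real (c m) * (w ^ m - w ^ (2 * n + 2 - m))) = 0"
  moreover define p where "p = (\<Sum>m\<le>n. monom (complex_of_real (c m)) m)"
  have p: "poly p z = (\<Sum>m\<le>n. of_real (c m) * z ^ m)" for z
    by (simp add: p_def poly_sum poly_monom)
  \<comment> \<open>Since \<open>c\<close> is real, \<open>cnj (poly p (1 / cnj w))\<close> is
    \<open>poly p (1 / w)\<close>. The reflection bound absorbs \<open>n\<close> of the
    \<open>2 * n + 2\<close> powers of \<open>w\<close>; the other \<open>n + 2\<close> make the
    comparison strict.\<close>
  have "(\<Sum>m\<le>n. of_real (c m) * w ^ (2 * n + 2 - m)) = w ^ (n + 2) * (w ^ n * cnj (poly p (1 / cnj w)))"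
    unfolding p cnj_sum sum_distrib_left
  proof (rule sum.cong)
    fix m assume "m \<in> {..n}"
    hence "2 * n + 2 - m = (n + 2) + (n - m)" "w ^ n = w ^ (n - m) * w ^ m"
      by (auto simp flip: power_add)
    thus "of_real (c m) * w ^ (2 * n + 2 - m)
            = w ^ (n + 2) * (w ^ n * cnj (of_real (c m) * (1 / cnj w) ^ m))"
      using w(2) by (simp only: power_add) (simp add: field_simps)
  qed auto
  ultimately have "poly p w = w ^ (n + 2) * (w ^ n * cnj (poly p (1 / cnj w)))"
    by (simp add: p ring_distribs sum_subtractf)
  hence "norm (poly p w) = norm w ^ (n + 2) * (norm w ^ n * norm (poly p (1 / cnj w)))"
    by (metis complex_mod_cnj norm_mult norm_power)
  also have "\<dots> \<le> norm w ^ (n + 2) * norm (poly p w)"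
  proof (intro mult_left_mono poly_reflection_le)
    show "norm z \<ge> 1" if "poly p z = 0" for z
      using enestrom_kakeya[of n c z] c that unfolding p by force
    show "degree p \<le> n"
      unfolding p_def by (intro degree_sum_le) (auto intro: order.trans[OF degree_monom_le])
  qed (use w in auto)
  finally have "norm (poly p w) \<le> norm w ^ (n + 2) * norm (poly p w)" .
  moreover have "norm w ^ (n + 2) < 1"
    using w power_Suc_less_one[of "norm w" "n + 1"] by simp
  moreover have "poly p w \<noteq> 0"
    unfolding p by (rule enestrom_kakeya) (use c w in auto)
  ultimately show False
    by (metis mult_less_cancel_right2 not_less zero_less_norm_iff)
qed

section \<open>Polynomial approximations\<close>

text \<open>This is the coefficient of \<open>x ^ n\<close> in
  \<open>x ^ j * (1 - x) powr (- 2 * j - \<beta>)\<close>. A geometric series in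
  \<open>u * x / (1 - x)^2\<close> then yields the generating function of
  \<open>disc_ml\<close>.\<close>

definition disc_ml_coeff :: "real \<Rightarrow> nat \<Rightarrow> nat \<Rightarrow> real" where
  "disc_ml_coeff \<beta> n j = (if j \<le> n then pochhammer (2 * real j + \<beta>) (n - j) / fact (n - j) else 0)"

definition disc_ml :: "real \<Rightarrow> nat \<Rightarrow> complex \<Rightarrow> complex" where
  "disc_ml \<beta> n u = (\<Sum>j\<le>n. of_real (disc_ml_coeff \<beta> n j) * u ^ j)"

lemma pochhammer_over_fact_diff:
  fixes s :: "'a :: field_char_0"
  shows "pochhammer s (Suc m) / fact (Suc m) - pochhammer s m / fact m
           = pochhammer (s - 1) (Suc m) / fact (Suc m)"
proof -
  have "pochhammer s (Suc m) = (s + of_nat m) * pochhammer s m"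
       "pochhammer (s - 1) (Suc m) = (s - 1) * pochhammer s m"
    by (simp_all add: pochhammer_rec'[of s] pochhammer_rec[of "s - 1"])
  moreover have "(of_nat m + 1 :: 'a) \<noteq> 0"
    by (metis of_nat_Suc of_nat_neq_0 add.commute)
  ultimately show ?thesis by (simp add: divide_simps) (simp add: algebra_simps)
qed

lemma disc_ml_coeff_rec_0:
  "disc_ml_coeff \<beta> (n + 2) 0 - 2 * disc_ml_coeff \<beta> (n + 1) 0 + disc_ml_coeff \<beta> n 0
     = pochhammer (\<beta> - 2) (n + 2) / fact (n + 2)"
  using pochhammer_over_fact_diff[of \<beta> "Suc n"] pochhammer_over_fact_diff[of \<beta> n]
    pochhammer_over_fact_diff[of "\<beta> - 1" "Suc n"]
  by (simp add: disc_ml_coeff_def del: fact_Suc)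

text \<open>A second difference in \<open>n\<close> multiplies the generating function by
  \<open>(1 - x)^2\<close>. This cancels two powers of the denominator and leaves \<open>x\<close>
  times the series for \<open>j\<close>.\<close>

lemma disc_ml_coeff_rec_Suc:
  "disc_ml_coeff \<beta> (n + 2) (Suc j) - 2 * disc_ml_coeff \<beta> (n + 1) (Suc j) + disc_ml_coeff \<beta> n (Suc j)
     = disc_ml_coeff \<beta> (n + 1) j"
proof -
  define s where "s = 2 * real (Suc j) + \<beta>"
  have s: "2 * real j + \<beta> = s - 2" by (simp add: s_def)
  consider "j < n" | "j = n" | "j = n + 1" | "j > n + 1" by linarith
  thus ?thesis
  proof cases
    case 1
    define m where "m = n - j - 1"
    have m: "n = j + 1 + m" using 1 by (simp add: m_def)
    show ?thesis
      using pochhammer_over_fact_diff[of s "Suc m"] pochhammer_over_fact_diff[of s m]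
        pochhammer_over_fact_diff[of "s - 1" "Suc m"] m
      by (simp add: disc_ml_coeff_def s s_def[symmetric] Suc_diff_le del: fact_Suc of_nat_Suc)
  qed (auto simp: disc_ml_coeff_def)
qed

lemma disc_ml_rec:
  "disc_ml \<beta> (n + 2) u - (2 + u) * disc_ml \<beta> (n + 1) u + disc_ml \<beta> n u
     = of_real (pochhammer (\<beta> - 2) (n + 2) / fact (n + 2))"
proof -
  let ?d = "\<lambda>n j. complex_of_real (disc_ml_coeff \<beta> n j)"
  \<comment> \<open>Coefficients beyond the diagonal are 0 by definition, so all three sums can
    share one index range.\<close>
  have ext: "disc_ml \<beta> k u = ?d k 0 + u * (\<Sum>j\<le>n + 1. ?d k (Suc j) * u ^ j)" if "k \<le> n + 2" for k
  proof -
    have "disc_ml \<beta> k u = (\<Sum>j\<le>Suc (n + 1). ?d k j * u ^ j)"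
      unfolding disc_ml_def using that by (intro sum.mono_neutral_left) (auto simp: disc_ml_coeff_def)
    thus ?thesis
      by (simp only: sum.atMost_Suc_shift) (simp add: sum_distrib_left mult_ac del: sum.atMost_Suc)
  qed
  have d: "?d (n + 2) (Suc j) - 2 * ?d (n + 1) (Suc j) + ?d n (Suc j) = ?d (n + 1) j" for j
    using arg_cong[OF disc_ml_coeff_rec_Suc[of \<beta> n j], of complex_of_real] by simp
  have "disc_ml \<beta> (n + 2) u - 2 * disc_ml \<beta> (n + 1) u + disc_ml \<beta> n u
      = (?d (n + 2) 0 - 2 * ?d (n + 1) 0 + ?d n 0) +
        u * (\<Sum>j\<le>n + 1. (?d (n + 2) (Suc j) - 2 * ?d (n + 1) (Suc j) + ?d n (Suc j)) * u ^ j)"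
    by (simp only: ext[of "n + 2"] ext[of "n + 1"] ext[of n])
       (simp add: algebra_simps sum.distrib sum_subtractf sum_distrib_left)
  also have "(\<Sum>j\<le>n + 1. (?d (n + 2) (Suc j) - 2 * ?d (n + 1) (Suc j) + ?d n (Suc j)) * u ^ j)
      = disc_ml \<beta> (n + 1) u"
    unfolding disc_ml_def d ..
  also have "?d (n + 2) 0 - 2 * ?d (n + 1) 0 + ?d n 0 = of_real (pochhammer (\<beta> - 2) (n + 2) / fact (n + 2))"
    using arg_cong[OF disc_ml_coeff_rec_0[of \<beta> n], of complex_of_real] by simp
  finally show ?thesis
    by (simp add: algebra_simps)
qed

text \<open>Here \<open>2 + u = w + 1 / w\<close>, so \<open>w\<close> and \<open>1 / w\<close> are
  the characteristic roots of the recurrence \<open>disc_ml_rec\<close>. The right side convolves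
  its inhomogeneous term with the homogeneous solution \<open>V\<close>. Both sides satisfy the same
  recurrence and agree for \<open>n = 0\<close> and \<open>n = 1\<close>.\<close>

lemma disc_ml_joukowski:
  assumes w: "w \<noteq> 0" and u: "u = (w - 1)\<^sup>2 / w"
  shows "disc_ml \<beta> n u * (w - inverse w)
           = (\<Sum>m\<le>n. of_real (pochhammer (\<beta> - 2) m / fact m) *
               (w ^ (n - m + 1) - inverse w ^ (n - m + 1)))"
proof -
  define c where "c = (\<lambda>m. complex_of_real (pochhammer (\<beta> - 2) m / fact m))"
  define V where "V = (\<lambda>k::nat. w ^ k - inverse w ^ k)"
  define v where "v = inverse w"
  have v: "w * v = 1" using w by (simp add: v_def)
  have wv: "w * (v * x) = x" "v * (w * x) = x" for x
    using v by (simp_all flip: mult.assoc) (simp add: mult.commute)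
  have u2: "2 + u = w + v" using w unfolding u v_def by (simp add: field_simps power2_eq_square)
  have V: "V (k + 2) = (2 + u) * V (k + 1) - V k" for k
    unfolding u2 by (simp add: V_def v_def[symmetric] algebra_simps wv)
  have V01: "V 0 = 0" "V (Suc 0) = w - v" "V 1 = w - v" by (simp_all add: V_def v_def)
  define R where "R = (\<lambda>n. \<Sum>m\<le>n. c m * V (n - m + 1))"
  have R: "R (n + 2) - (2 + u) * R (n + 1) + R n = c (n + 2) * (w - v)" for n
  proof -
    have "(\<Sum>m\<le>n. c m * V (n + 2 - m + 1))
        = (\<Sum>m\<le>n. c m * ((2 + u) * V (n + 1 - m + 1) - V (n - m + 1)))"
    proof (rule sum.cong)
      fix m assume "m \<in> {..n}"
      hence "n + 2 - m + 1 = (n - m + 1) + 2" "n + 1 - m + 1 = (n - m + 1) + 1" by auto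
      thus "c m * V (n + 2 - m + 1) = c m * ((2 + u) * V (n + 1 - m + 1) - V (n - m + 1))"
        by (simp only: V)
    qed auto
    moreover have "c (n + 1) * V (Suc (Suc 0)) = c (n + 1) * ((2 + u) * (w - v))"
      using V[of 0] V01 by (simp add: numeral_2_eq_2)
    ultimately show ?thesis
      unfolding R_def by (simp add: V01 algebra_simps sum_distrib_left sum_subtractf sum.distrib)
  qed
  have "disc_ml \<beta> n u * (w - v) = R n"
  proof (induction n rule: less_induct)
    case (less n)
    consider "n = 0" | "n = 1" | k where "n = k + 2"
      by (metis One_nat_def add_2_eq_Suc' nat.exhaust)
    thus ?case
    proof cases
      case 1
      thus ?thesis by (simp add: R_def V01 c_def disc_ml_def disc_ml_coeff_def)
    next
      case 2
      have "V (Suc (Suc 0)) = (2 + u) * (w - v)"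
        using V[of 0] V01 by (simp add: numeral_2_eq_2)
      thus ?thesis using 2
        by (simp add: R_def V01 c_def disc_ml_def disc_ml_coeff_def algebra_simps)
    next
      case 3
      have dn: "disc_ml \<beta> n u = (2 + u) * disc_ml \<beta> (k + 1) u - disc_ml \<beta> k u + c (k + 2)"
        using disc_ml_rec[of \<beta> k u] 3 by (simp add: c_def algebra_simps)
      have "disc_ml \<beta> n u * (w - v) = (2 + u) * (disc_ml \<beta> (k + 1) u * (w - v))
               - disc_ml \<beta> k u * (w - v) + c (k + 2) * (w - v)"
        unfolding dn by (simp add: algebra_simps)
      also have "disc_ml \<beta> (k + 1) u * (w - v) = R (k + 1)"
        using less[of "k + 1"] 3 by simp
      also have "disc_ml \<beta> k u * (w - v) = R k"
        using less[of k] 3 by simp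
      also have "(2 + u) * R (k + 1) - R k + c (k + 2) * (w - v) = R (k + 2)"
        using R[of k] by (simp add: algebra_simps)
      finally show ?thesis using 3 by simp
    qed
  qed
  thus ?thesis by (simp add: R_def V_def c_def v_def)
qed

text \<open>The two roots of \<open>t^2 - (2 + u) * t + 1\<close> have product 1, so one of them
  lies in the closed unit disc.\<close>

lemma joukowski_preimage:
  fixes u :: complex
  obtains w where "w \<noteq> 0" "norm w \<le> 1" "u = (w - 1)\<^sup>2 / w"
proof -
  define s where "s = csqrt ((2 + u)\<^sup>2 - 4)"
  define w where "w = ((2 + u) + s) / 2"
  define v where "v = ((2 + u) - s) / 2"
  have s: "s\<^sup>2 = (2 + u)\<^sup>2 - 4" by (simp add: s_def)
  have "w * v = ((2 + u)\<^sup>2 - s\<^sup>2) / 4" by (simp add: w_def v_def power2_eq_square algebra_simps)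
  hence wv: "w * v = 1" by (simp add: s)
  hence nz: "w \<noteq> 0" "v \<noteq> 0" by auto
  have sum: "w + v = 2 + u" by (simp add: w_def v_def field_simps)
  have u: "u = (w - 1)\<^sup>2 / w" "u = (v - 1)\<^sup>2 / v"
  proof -
    have "u * w = (w - 1)\<^sup>2" "u * v = (v - 1)\<^sup>2" using wv sum by algebra+
    thus "u = (w - 1)\<^sup>2 / w" "u = (v - 1)\<^sup>2 / v" using nz by (simp_all add: field_simps)
  qed
  have "norm w * norm v = 1" using wv by (metis norm_mult norm_one)
  hence "norm w \<le> 1 \<or> norm v \<le> 1"
    using less_1_mult[of "norm w" "norm v"] by linarith
  thus ?thesis using that u nz by blast
qed

text \<open>The range of \<beta> enters through \<open>c\<close>: \<open>\<beta> \<ge> 2\<close>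
  makes it nonnegative and \<open>\<beta> \<le> 3\<close> nonincreasing. This excludes a preimage
  \<open>w\<close> inside the disc, and on the circle \<open>u = 2 * Re w - 2\<close>.\<close>

lemma disc_ml_zero_imp_nonpos_real:
  assumes \<beta>: "2 \<le> \<beta>" "\<beta> \<le> 3" and zero: "disc_ml \<beta> n u = 0"
  shows "u \<in> \<real>\<^sub>\<le>\<^sub>0"
proof -
  obtain w where w: "w \<noteq> 0" "norm w \<le> 1" "u = (w - 1)\<^sup>2 / w"
    by (rule joukowski_preimage)
  define c where "c = (\<lambda>m. pochhammer (\<beta> - 2) m / fact m)"
  have c0: "c m \<ge> 0" for m
    using \<beta> by (auto simp: c_def pochhammer_nonneg pochhammer_prod intro!: divide_nonneg_pos prod_nonneg)
  have cdec: "c (Suc m) \<le> c m" for m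
  proof -
    have "c (Suc m) = c m * ((\<beta> - 2 + m) / (m + 1))"
      by (simp add: c_def pochhammer_rec' field_simps)
    also have "\<dots> \<le> c m * 1"
      using \<beta> by (intro mult_left_mono c0) (auto simp: field_simps)
    finally show ?thesis by simp
  qed
  show ?thesis
  proof (cases "norm w = 1")
    case True
    have inv: "inverse w = cnj w"
      using True complex_norm_square[of w] by (intro inverse_unique) simp
    have "u = w + inverse w - 2" using w(1,3) by (simp add: field_simps power2_eq_square)
    also have "\<dots> = of_real (2 * Re w - 2)" unfolding inv by (simp add: complex_eq_iff)
    finally have "u = of_real (2 * Re w - 2)" .
    moreover have "Re w \<le> 1" using complex_Re_le_cmod[of w] True by simp
    ultimately show ?thesis by (simp del: of_real_diff of_real_mult)
  next
    case False
    hence w1: "norm w < 1" using w by simp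
    have "(\<Sum>m\<le>n. of_real (c m) * (w ^ m - w ^ (2 * n + 2 - m)))
        = -(w ^ (n + 1)) * (\<Sum>m\<le>n. of_real (c m) * (w ^ (n - m + 1) - inverse w ^ (n - m + 1)))"
      unfolding sum_distrib_left
    proof (rule sum.cong)
      fix m assume "m \<in> {..n}"
      then obtain k where k: "n = m + k" by (metis atMost_iff nat_le_iff_add)
      have "2 * n + 2 - m = (n + 1) + (k + 1)" "n - m + 1 = k + 1" using k by auto
      moreover have "w ^ (n + 1) * inverse w ^ (k + 1) = w ^ m"
        using w(1) k by (simp add: field_simps power_add)
      ultimately show "of_real (c m) * (w ^ m - w ^ (2 * n + 2 - m))
          = -(w ^ (n + 1)) * (of_real (c m) * (w ^ (n - m + 1) - inverse w ^ (n - m + 1)))"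
        by (simp only: power_add[of w "n + 1" "k + 1"]) (simp add: algebra_simps)
    qed auto
    also have "\<dots> = 0"
      using disc_ml_joukowski[OF w(1,3), of \<beta> n] zero by (simp add: c_def)
    finally show ?thesis
      using antipalindromic_sum_nonzero[of n c w] c0 cdec w w1 by (simp add: c_def)
  qed
qed

text \<open>
  The coefficients of \<open>disc_ml \<beta> n (z / (n (n + \<beta>)))\<close>, relative to those of the Mittag-Leffler series
  and normalised to be \<open>1\<close> at \<open>j = 0\<close>. Scaling by \<open>n (n + \<beta>)\<close> instead of \<open>n\<^sup>2\<close> keeps them at most \<open>1\<close>.
\<close>
definition ml_weight :: "real \<Rightarrow> nat \<Rightarrow> nat \<Rightarrow> real" where
  "ml_weight \<beta> n j = (\<Prod>i<j. (real n - real i) * (real n + \<beta> + real i) / (real n * (real n + \<beta>)))"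

lemma ml_weight_eq_0: "n < j \<Longrightarrow> ml_weight \<beta> n j = 0"
  by (auto simp: ml_weight_def prod_zero_iff)

lemma ml_weight_bounds:
  assumes "\<beta> > 0"
  shows "0 \<le> ml_weight \<beta> n j \<and> ml_weight \<beta> n j \<le> 1"
proof (cases "j \<le> n")
  case True
  have "0 \<le> (real n - real i) * (real n + \<beta> + real i) / (real n * (real n + \<beta>)) \<and>
        (real n - real i) * (real n + \<beta> + real i) / (real n * (real n + \<beta>)) \<le> 1" if "i < j" for i
  proof -
    have "(real n - real i) * (real n + \<beta> + real i) = real n * (real n + \<beta>) - real i * (\<beta> + real i)"
      by (simp add: algebra_simps)
    moreover have "real i * (\<beta> + real i) \<ge> 0" using assms by simp
    moreover have "(real n - real i) * (real n + \<beta> + real i) \<ge> 0" "real n * (real n + \<beta>) > 0"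
      using that True assms by auto
    ultimately show ?thesis by (auto simp: divide_simps)
  qed
  thus ?thesis unfolding ml_weight_def by (intro conjI prod_nonneg prod_le_1) auto
qed (simp add: ml_weight_eq_0)

lemma ml_weight_tendsto:
  assumes "\<beta> > 0"
  shows "(\<lambda>n. ml_weight \<beta> n j) \<longlonglongrightarrow> 1"
proof -
  have "(\<lambda>n. (real n - real i) * (real n + \<beta> + real i) / (real n * (real n + \<beta>))) \<longlonglongrightarrow> 1" for i
    using assms by real_asymp
  hence "(\<lambda>n. \<Prod>i<j. (real n - real i) * (real n + \<beta> + real i) / (real n * (real n + \<beta>))) \<longlonglongrightarrow> (\<Prod>i<j. 1)"
    by (intro tendsto_prod)
  thus ?thesis by (simp add: ml_weight_def)
qed

text \<open>Clearing \<open>Gamma (2 * j + \<beta>)\<close> turns the coefficient into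
  \<open>Gamma (n + j + \<beta>) / fact (n - j)\<close>. Passing from \<open>j\<close> to
  \<open>j + 1\<close> multiplies this by \<open>(n - j) * (n + \<beta> + j)\<close>, which is the
  scale times the new factor of the weight.\<close>

lemma disc_ml_coeff_eq_weight:
  assumes "\<beta> > 0" "n > 0"
  shows "disc_ml_coeff \<beta> n j = Gamma (real n + \<beta>) / fact n * (real n * (real n + \<beta>)) ^ j *
           (ml_weight \<beta> n j * rGamma (2 * real j + \<beta>))"
proof (cases "j \<le> n")
  case True
  have pos_not_nonpos: "x \<notin> \<int>\<^sub>\<le>\<^sub>0" if "x > 0" for x :: real
    using that nonpos_Ints_nonpos[of x] by auto
  have pos: "2 * real j + \<beta> > 0"
    using assms(1) by (intro add_nonneg_pos) auto
  have Gpos: "Gamma (2 * real j + \<beta>) > 0"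
    by (intro Gamma_real_pos pos)
  have G: "Gamma (2 * real j + \<beta>) * rGamma (2 * real j + \<beta>) = 1"
    unfolding rGamma_inverse_Gamma using Gpos by (intro right_inverse) linarith
  have "disc_ml_coeff \<beta> n j * Gamma (2 * real j + \<beta>) = Gamma (real n + real j + \<beta>) / fact (n - j)"
  proof -
    have "2 * real j + \<beta> + real (n - j) = real n + real j + \<beta>" using True by simp
    hence "pochhammer (2 * real j + \<beta>) (n - j) * Gamma (2 * real j + \<beta>) = Gamma (real n + real j + \<beta>)"
      using pochhammer_Gamma[OF pos_not_nonpos[OF pos], of "n - j"] Gpos
      by (metis less_numeral_extra(3) nonzero_eq_divide_eq)
    thus ?thesis using True by (simp add: disc_ml_coeff_def)
  qed
  also have "\<dots> = Gamma (real n + \<beta>) / fact n * (real n * (real n + \<beta>)) ^ j * ml_weight \<beta> n j"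
    using True
  proof (induction j)
    case (Suc j)
    have "fact (n - j) = (real n - real j) * fact (n - Suc j)"
      using Suc.prems fact_reduce[of "n - j", where 'a = real] by (simp add: of_nat_diff)
    moreover have "Gamma (real n + real (Suc j) + \<beta>) = (real n + real j + \<beta>) * Gamma (real n + real j + \<beta>)"
      using Gamma_plus1[of "real n + real j + \<beta>"] assms pos_not_nonpos by (simp add: add_ac)
    ultimately have "Gamma (real n + real (Suc j) + \<beta>) / fact (n - Suc j)
       = (real n - real j) * (real n + real j + \<beta>) * (Gamma (real n + real j + \<beta>) / fact (n - j))"
      using Suc.prems by simp
    also have "Gamma (real n + real j + \<beta>) / fact (n - j) =
        Gamma (real n + \<beta>) / fact n * (real n * (real n + \<beta>)) ^ j * ml_weight \<beta> n j"
      using Suc by simp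
    finally show ?case
      using assms by (simp add: ml_weight_def add_ac)
  qed (simp add: ml_weight_def)
  finally show ?thesis
    using G by (metis (no_types, lifting) mult.assoc mult.right_neutral)
qed (simp add: disc_ml_coeff_def ml_weight_eq_0)

section \<open>Polynomials with real zeros\<close>

text \<open>The logarithmic derivative of a product, times \<open>z\<close>. It turns
  \<open>\<beta> p + 2 z p'\<close> into a sum over the roots.\<close>

lemma poly_nonpos_roots_euler:
  fixes A :: "complex multiset"
  assumes A: "\<And>x. x \<in># A \<Longrightarrow> x \<in> \<real>\<^sub>\<le>\<^sub>0" and z: "z \<notin> \<real>\<^sub>\<le>\<^sub>0"
  defines "p \<equiv> \<Prod>x\<in>#A. [:-x, 1:]"
  shows "poly p z \<noteq> 0" "z * poly (pderiv p) z = poly p z * (\<Sum>x\<in>#A. z / (z - x))"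
proof -
  have "poly (\<Prod>x\<in>#A. [:-x, 1:]) z \<noteq> 0 \<and>
      z * poly (pderiv (\<Prod>x\<in>#A. [:-x, 1:])) z
        = poly (\<Prod>x\<in>#A. [:-x, 1:]) z * (\<Sum>x\<in>#A. z / (z - x))"
    using A
  proof (induction A)
    case (add x A)
    let ?P = "\<Prod>x\<in>#A. [:-x, 1:]"
    have nz: "z - x \<noteq> 0" using add.prems[of x] z by auto
    have 1: "z * poly (pderiv ?P) z = poly ?P z * (\<Sum>x\<in>#A. z / (z - x))" and 2: "poly ?P z \<noteq> 0"
      using add by auto
    have "pderiv (\<Prod>x\<in>#add_mset x A. [:-x, 1:]) = [:-x, 1:] * pderiv ?P + ?P"
      by (simp only: image_mset_add_mset prod_mset.add_mset pderiv_mult) (simp add: pderiv_pCons)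
    hence "z * poly (pderiv (\<Prod>x\<in>#add_mset x A. [:-x, 1:])) z
        = (z - x) * (z * poly (pderiv ?P) z) + z * poly ?P z"
      by (simp only:) (simp add: algebra_simps)
    also have "\<dots> = (z - x) * poly ?P z * (\<Sum>x\<in>#add_mset x A. z / (z - x))"
      unfolding 1 using nz by (simp add: field_simps)
    finally show ?case using 2 nz by (simp add: algebra_simps)
  qed auto
  thus "poly p z \<noteq> 0" "z * poly (pderiv p) z = poly p z * (\<Sum>x\<in>#A. z / (z - x))"
    unfolding p_def by auto
qed

text \<open>
  Off the nonpositive half-line, all the numbers \<open>z / (z - x)\<close> lie in the closed sector between
  the positive half-line and the ray through \<open>z\<close>, so they cannot cancel.
\<close>
lemma sum_nonpos_roots_nonzero:
  fixes A :: "complex multiset"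
  assumes A: "\<And>x. x \<in># A \<Longrightarrow> x \<in> \<real>\<^sub>\<le>\<^sub>0" and z: "z \<notin> \<real>\<^sub>\<le>\<^sub>0"
    and \<beta>: "\<beta> \<ge> 0" "\<beta> > 0 \<or> A \<noteq> {#}"
  shows "of_real \<beta> + 2 * (\<Sum>x\<in>#A. z / (z - x)) \<noteq> 0"
proof -
  have nz: "z \<noteq> 0" using z by auto
  have rpos: "norm z + Re z > 0"
  proof (rule ccontr)
    assume "\<not> norm z + Re z > 0"
    hence "norm z = - Re z" using abs_Re_le_cmod[of z] by linarith
    hence "Im z = 0 \<and> Re z \<le> 0"
      by (metis Im_eq_0 abs_minus_cancel abs_of_nonneg neg_0_le_iff_le norm_ge_zero)
    thus False using z by (simp add: complex_nonpos_Reals_iff)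
  qed
  \<comment> \<open>\<open>\<phi>\<close> is the real inner product with \<open>norm z + z\<close>,
    which points along the bisector of the sector.\<close>
  define \<phi> where "\<phi> = (\<lambda>v. (norm z + Re z) * Re v + Im z * Im v)"
  have \<phi>_add: "\<phi> (a + b) = \<phi> a + \<phi> b" for a b by (simp add: \<phi>_def algebra_simps)
  have \<phi>_pos: "\<phi> (z / (z - x)) > 0" if "x \<in> \<real>\<^sub>\<le>\<^sub>0" for x
  proof -
    obtain a where a: "x = - of_real a" "a \<ge> 0"
      using \<open>x \<in> \<real>\<^sub>\<le>\<^sub>0\<close> by (elim nonpos_Reals_cases) (metis minus_minus neg_0_le_iff_le of_real_minus)
    have nzx: "z - x \<noteq> 0" using that z by auto
    have "z / (z - x) = z * cnj (z - x) / of_real ((norm (z - x))\<^sup>2)"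
      by (metis complex_div_cnj of_real_power)
    hence "Re (z / (z - x)) = Re (z * cnj (z - x)) / (norm (z - x))\<^sup>2"
          "Im (z / (z - x)) = Im (z * cnj (z - x)) / (norm (z - x))\<^sup>2"
      by (simp_all only: Re_divide_of_real Im_divide_of_real)
    hence "\<phi> (z / (z - x)) = \<phi> (z * cnj (z - x)) / (norm (z - x))\<^sup>2"
      unfolding \<phi>_def by (simp only: times_divide_eq_right add_divide_distrib)
    also have "\<phi> (z * cnj (z - x)) = (norm z)\<^sup>2 * (norm z + Re z) + a * norm z * (norm z + Re z)"
      by (simp add: \<phi>_def a cmod_power2) (simp add: cmod_def algebra_simps power2_eq_square)
    finally have \<phi>_eq: "\<phi> (z / (z - x)) =
      ((norm z)\<^sup>2 * (norm z + Re z) + a * norm z * (norm z + Re z)) / (norm (z - x))\<^sup>2" .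
    have "(norm z)\<^sup>2 * (norm z + Re z) + a * norm z * (norm z + Re z) > 0"
    proof (rule add_pos_nonneg)
      show "(norm z)\<^sup>2 * (norm z + Re z) > 0" using rpos nz by (simp del: zero_less_power2)
      show "a * norm z * (norm z + Re z) \<ge> 0" using rpos a by (simp add: mult_nonneg_nonneg del: zero_le_mult_iff)
    qed
    thus ?thesis unfolding \<phi>_eq using nzx by (intro divide_pos_pos) auto
  qed
  have "\<phi> (\<Sum>x\<in>#A. z / (z - x)) \<ge> 0 \<and> (A \<noteq> {#} \<longrightarrow> \<phi> (\<Sum>x\<in>#A. z / (z - x)) > 0)"
    using A
  proof (induction A)
    case (add x A)
    thus ?case using \<phi>_pos[of x] by (auto simp: \<phi>_add add_pos_nonneg intro!: add_nonneg_nonneg)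
  qed (simp add: \<phi>_def)
  moreover have "\<phi> (of_real \<beta>) \<ge> 0 \<and> (\<beta> > 0 \<longrightarrow> \<phi> (of_real \<beta>) > 0)"
    using rpos \<beta> by (auto simp: \<phi>_def)
  ultimately have "\<phi> (of_real \<beta> + 2 * (\<Sum>x\<in>#A. z / (z - x))) > 0"
    using \<beta> unfolding mult_2 \<phi>_add by (auto intro: add_pos_nonneg add_nonneg_pos)
  moreover have "\<phi> 0 = 0" by (simp add: \<phi>_def)
  ultimately show ?thesis by (metis less_irrefl)
qed

text \<open>Off the half-line the new polynomial is \<open>p\<close> times
  \<open>\<beta> + 2 * (\<Sum>x\<in>#A. z / (z - x))\<close>, and neither factor vanishes. For
  \<open>\<beta> = 0\<close> the operator kills constants, hence the condition on the
  degree.\<close>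

lemma nonpos_roots_euler_operator:
  fixes p :: "complex poly"
  assumes roots: "\<And>z. poly p z = 0 \<Longrightarrow> z \<in> \<real>\<^sub>\<le>\<^sub>0" and \<beta>: "\<beta> \<ge> 0" "\<beta> > 0 \<or> degree p > 0"
    and zero: "poly (smult (of_real \<beta>) p + smult 2 (pCons 0 (pderiv p))) z = 0"
  shows "z \<in> \<real>\<^sub>\<le>\<^sub>0"
proof (rule ccontr)
  assume z: "z \<notin> \<real>\<^sub>\<le>\<^sub>0"
  have p0: "p \<noteq> 0" using roots[of 1] by (auto simp: complex_nonpos_Reals_iff)
  obtain A where A: "size A = degree p" "p = smult (lead_coeff p) (\<Prod>x\<in>#A. [:-x, 1:])"
    using alg_closed_imp_factorization[OF p0] by blast
  have Anp: "x \<in> \<real>\<^sub>\<le>\<^sub>0" if "x \<in># A" for x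
  proof (rule roots)
    show "poly p x = 0"
      by (subst A(2)) (use that in \<open>auto simp: poly_prod_mset prod_mset_zero_iff\<close>)
  qed
  let ?P = "\<Prod>x\<in>#A. [:-x, 1:]"
  define l where "l = lead_coeff p"
  have pl: "p = smult l ?P" "l \<noteq> 0" using A(2) p0 by (simp_all add: l_def)
  note eul = poly_nonpos_roots_euler[OF Anp z]
  have "0 = of_real \<beta> * poly p z + 2 * (z * poly (pderiv p) z)" using zero by (simp add: mult_ac)
  also have "\<dots> = l * (of_real \<beta> * poly ?P z + 2 * (z * poly (pderiv ?P) z))"
    by (simp add: pl(1) pderiv_smult algebra_simps)
  also have "\<dots> = l * poly ?P z * (of_real \<beta> + 2 * (\<Sum>x\<in>#A. z / (z - x)))"
    using eul(2) by (simp add: algebra_simps)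
  finally have "of_real \<beta> + 2 * (\<Sum>x\<in>#A. z / (z - x)) = 0"
    using eul(1) pl(2) by auto
  moreover have "of_real \<beta> + 2 * (\<Sum>x\<in>#A. z / (z - x)) \<noteq> 0"
    using \<beta> A(1) by (intro sum_nonpos_roots_nonzero[OF Anp z]) auto
  ultimately show False by contradiction
qed

text \<open>For a real root \<open>x\<close>, the distance \<open>norm (z - x)\<close> grows with
  \<open>\<bar>Im z\<bar>\<close>; multiply over the roots.\<close>

lemma norm_poly_mono_Im:
  fixes p :: "complex poly"
  assumes roots: "\<And>z. poly p z = 0 \<Longrightarrow> z \<in> \<real>" and "Re z = Re z'" "\<bar>Im z\<bar> \<le> \<bar>Im z'\<bar>"
  shows "norm (poly p z) \<le> norm (poly p z')"
proof (cases "p = 0")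
  case False
  obtain A where A: "size A = degree p" "p = smult (lead_coeff p) (\<Prod>x\<in>#A. [:-x, 1:])"
    using alg_closed_imp_factorization[OF False] by blast
  have Areal: "x \<in> \<real>" if "x \<in># A" for x
  proof (rule roots)
    show "poly p x = 0"
      by (subst A(2)) (use that in \<open>auto simp: poly_prod_mset prod_mset_zero_iff\<close>)
  qed
  have "norm (poly (\<Prod>x\<in>#A. [:-x, 1:]) z) \<le> norm (poly (\<Prod>x\<in>#A. [:-x, 1:]) z')"
    using Areal
  proof (induction A)
    case (add x A)
    have pm: "poly (\<Prod>x\<in>#add_mset x A. [:-x, 1:]) z = (z - x) * poly (\<Prod>x\<in>#A. [:-x, 1:]) z" for z
      by (simp add: algebra_simps)
    have "Im x = 0" using add.prems[of x] by (simp add: complex_is_Real_iff)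
    hence "norm (z - x) \<le> norm (z' - x)"
      using assms(2,3) by (simp add: cmod_def abs_le_square_iff)
    thus ?case unfolding pm norm_mult using add by (intro mult_mono) auto
  qed auto
  thus ?thesis by (subst (1 2) A(2)) (simp add: norm_mult mult_left_mono)
qed auto

section \<open>The range up to 3\<close>

definition ml_real :: "real \<Rightarrow> real \<Rightarrow> real" where
  "ml_real \<beta> x = (\<Sum>k. x ^ k * rGamma (2 * real k + \<beta>))"

lemma summable_ml_real: "summable (\<lambda>k. x ^ k * rGamma (2 * real k + \<beta>))"
proof -
  have "summable (\<lambda>k. complex_of_real (x ^ k * rGamma (2 * real k + \<beta>)))"
    using summable_mittag_leffler_2[of "of_real x" \<beta>] by (simp only: rGamma_complex_of_real) simp
  thus ?thesis by (simp only: summable_of_real_iff)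
qed

lemma mittag_leffler_2_of_real': "mittag_leffler 2 \<beta> (of_real x) = of_real (ml_real \<beta> x)"
proof -
  have "(\<lambda>k. complex_of_real (x ^ k * rGamma (2 * real k + \<beta>))) sums of_real (ml_real \<beta> x)"
    unfolding sums_of_real_iff ml_real_def by (intro summable_sums summable_ml_real)
  thus ?thesis
    unfolding mittag_leffler_def by (simp only: rGamma_complex_of_real of_real_mult of_real_power sums_iff)
qed

lemma rGamma_real_pos: "x > 0 \<Longrightarrow> rGamma (x::real) > 0"
  by (simp add: rGamma_inverse_Gamma Gamma_real_pos)

lemma rGamma_real_nonneg: "x \<ge> 0 \<Longrightarrow> rGamma (x::real) \<ge> 0"
  using rGamma_real_pos[of x] by (cases "x = 0") auto

lemma ml_real_less:
  assumes "\<beta> \<ge> 0" "0 \<le> x" "x < y"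
  shows "ml_real \<beta> x < ml_real \<beta> y"
proof -
  have "0 < (\<Sum>k. y ^ k * rGamma (2 * real k + \<beta>) - x ^ k * rGamma (2 * real k + \<beta>))"
  \<comment> \<open>The linear term is strict: its coefficient \<open>rGamma (2 + \<beta>)\<close>
    is positive even for \<open>\<beta> = 0\<close>.\<close>
  proof (rule suminf_pos2[of _ 1])
    show "0 \<le> y ^ k * rGamma (2 * real k + \<beta>) - x ^ k * rGamma (2 * real k + \<beta>)" for k
      using assms by (simp add: mult_right_mono power_mono rGamma_real_nonneg)
    show "0 < y ^ 1 * rGamma (2 * real 1 + \<beta>) - x ^ 1 * rGamma (2 * real 1 + \<beta>)"
      using assms by (simp add: rGamma_real_pos)
  qed (intro summable_diff summable_ml_real)
  thus ?thesis
    by (simp add: ml_real_def suminf_diff[OF summable_ml_real summable_ml_real, symmetric])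
qed

lemma ml_real_0: "ml_real \<beta> 0 = rGamma \<beta>"
  unfolding ml_real_def by (subst suminf_finite[of "{0}"]) auto

lemma ml_real_pos: "\<beta> \<ge> 0 \<Longrightarrow> x > 0 \<Longrightarrow> ml_real \<beta> x > 0"
  using ml_real_less[of \<beta> 0 x] rGamma_real_nonneg[of \<beta>] by (simp add: ml_real_0)

lemma mittag_leffler_2_holomorphic: "mittag_leffler 2 \<beta> holomorphic_on S"
proof -
  have "mittag_leffler 2 \<beta> holomorphic_on ball 0 (norm z + 1)" for z
  proof (rule power_series_holomorphic)
    fix w
    show "(\<lambda>n. rGamma (complex_of_real (2 * real n + \<beta>)) * (w - 0) ^ n) sums mittag_leffler 2 \<beta> w"
      using summable_sums[OF summable_mittag_leffler_2[of w \<beta>]]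
      by (simp add: mittag_leffler_def mult.commute)
  qed
  hence "mittag_leffler 2 \<beta> field_differentiable (at z)" for z
    by (rule holomorphic_on_imp_differentiable_at[of _ "ball 0 (norm z + 1)"]) auto
  thus ?thesis
    by (auto simp: holomorphic_on_def intro: field_differentiable_at_within)
qed

text \<open>The weights belong to \<open>b\<close>, the Gamma factors to \<open>\<beta>\<close>.
  With \<open>b\<close> kept fixed, the Euler operator lowers \<open>\<beta>\<close>
  exactly.\<close>

definition ml_poly :: "real \<Rightarrow> real \<Rightarrow> nat \<Rightarrow> complex poly" where
  "ml_poly b \<beta> n = (\<Sum>j\<le>n. monom (of_real (ml_weight b n j * rGamma (2 * real j + \<beta>))) j)"

lemma coeff_ml_poly: "coeff (ml_poly b \<beta> n) j = of_real (ml_weight b n j * rGamma (2 * real j + \<beta>))"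
  by (auto simp: ml_poly_def coeff_sum ml_weight_eq_0 if_distrib cong: if_cong)

lemma poly_ml_poly:
  "poly (ml_poly b \<beta> n) z = (\<Sum>j. z ^ j * of_real (ml_weight b n j * rGamma (2 * real j + \<beta>)))"
  by (subst suminf_finite[of "{..n}"])
     (auto simp: ml_poly_def poly_sum poly_monom ml_weight_eq_0 mult.commute)

text \<open>Tannery's theorem: each weight tends to 1, and as the weights lie in [0, 1], the
  absolutely convergent limit series dominates.\<close>

lemma ml_poly_tendsto:
  assumes b: "b > 0"
  shows "(\<lambda>n. poly (ml_poly b \<beta> n) z) \<longlonglongrightarrow> mittag_leffler 2 \<beta> z"
proof -
  let ?r = "\<lambda>j. complex_of_real (rGamma (2 * real j + \<beta>))"
  have "summable (\<lambda>j. ?r j * of_real (norm z + 1) ^ j)"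
    using summable_mittag_leffler_2[of "of_real (norm z + 1)" \<beta>]
    by (simp only: rGamma_complex_of_real mult.commute)
  hence sm: "summable (\<lambda>j. norm (?r j * z ^ j))"
    by (rule powser_insidea) (simp add: norm_of_real)
  have "(\<lambda>n. \<Sum>j. z ^ j * of_real (ml_weight b n j * rGamma (2 * real j + \<beta>)))
          \<longlonglongrightarrow> (\<Sum>j. z ^ j * of_real (1 * rGamma (2 * real j + \<beta>)))"
  proof (rule tannerys_theorem[THEN conjunct2, THEN conjunct2])
    show "(\<lambda>n. z ^ j * complex_of_real (ml_weight b n j * rGamma (2 * real j + \<beta>)))
            \<longlonglongrightarrow> z ^ j * complex_of_real (1 * rGamma (2 * real j + \<beta>))" for j
      by (intro tendsto_intros ml_weight_tendsto b)
    have "norm (z ^ j * complex_of_real (ml_weight b n j * rGamma (2 * real j + \<beta>)))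
            \<le> norm (?r j * z ^ j)" for j n
      using ml_weight_bounds[OF b, of n j]
      by (simp add: norm_mult mult.commute mult_left_mono mult_right_le_one_le abs_mult
           mult_left_le_one_le)
    thus "\<forall>\<^sub>F (j, n) in sequentially \<times>\<^sub>F sequentially.
        norm (z ^ j * complex_of_real (ml_weight b n j * rGamma (2 * real j + \<beta>))) \<le> norm (?r j * z ^ j)"
      by (intro always_eventually) auto
  qed (use sm in auto)
  thus ?thesis
    by (simp add: poly_ml_poly mittag_leffler_def flip: rGamma_complex_of_real)
qed

text \<open>With equal parameters the polynomial is \<open>disc_ml\<close> at \<open>z / N\<close>,
  up to a positive constant.\<close>

lemma ml_poly_roots_base:
  assumes b: "2 \<le> b" "b \<le> 3" and n: "n > 0" and zero: "poly (ml_poly b b n) z = 0"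
  shows "z \<in> \<real>\<^sub>\<le>\<^sub>0"
proof -
  define N where "N = real n * (real n + b)"
  have N: "N > 0" using b n by (simp add: N_def)
  have "disc_ml b n (z / of_real N) = of_real (Gamma (real n + b) / fact n) * poly (ml_poly b b n) z"
    unfolding disc_ml_def ml_poly_def poly_sum sum_distrib_left poly_monom
  proof (rule sum.cong)
    fix j
    show "of_real (disc_ml_coeff b n j) * (z / of_real N) ^ j = of_real (Gamma (real n + b) / fact n) *
            (of_real (ml_weight b n j * rGamma (2 * real j + b)) * z ^ j)"
      using b n N by (subst disc_ml_coeff_eq_weight) (auto simp: N_def[symmetric] power_divide)
  qed auto
  hence "z / of_real N \<in> \<real>\<^sub>\<le>\<^sub>0"
    using zero by (intro disc_ml_zero_imp_nonpos_real[OF b]) auto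
  thus ?thesis
    using N by (auto simp: complex_nonpos_Reals_iff Re_divide_of_real Im_divide_of_real divide_le_0_iff)
qed

text \<open>By the functional equation of Gamma, lowering \<open>\<beta> + 1\<close> to
  \<open>\<beta>\<close> multiplies the coefficient of index \<open>j\<close> by
  \<open>2 * j + \<beta>\<close>, which is what \<open>\<beta> p + 2 z p'\<close> does.\<close>

lemma ml_poly_roots_step:
  assumes b: "b > 0" and \<beta>: "\<beta> \<ge> 0" and n: "n > 0"
    and IH: "\<And>z. poly (ml_poly b (\<beta> + 1) n) z = 0 \<Longrightarrow> z \<in> \<real>\<^sub>\<le>\<^sub>0"
    and zero: "poly (ml_poly b \<beta> n) z = 0"
  shows "z \<in> \<real>\<^sub>\<le>\<^sub>0"
proof (rule nonpos_roots_euler_operator[OF IH \<beta>])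
  let ?p = "ml_poly b (\<beta> + 1) n"
  have "ml_weight b n 1 = 1" using b n by (simp add: ml_weight_def)
  hence "coeff ?p 1 \<noteq> 0"
    using \<beta> rGamma_real_pos[of "3 + \<beta>"] by (simp add: coeff_ml_poly algebra_simps)
  thus "\<beta> > 0 \<or> degree ?p > 0"
    using le_degree[of ?p 1] by simp
  have rG: "rGamma (2 * real j + \<beta>) = (2 * real j + \<beta>) * rGamma (2 * real j + (\<beta> + 1))" for j
    using rGamma_plus1[of "2 * real j + \<beta>"] by (simp add: add_ac)
  have "ml_poly b \<beta> n = smult (of_real \<beta>) ?p + smult 2 (pCons 0 (pderiv ?p))"
  proof (rule poly_eqI)
    fix j
    show "coeff (ml_poly b \<beta> n) j = coeff (smult (of_real \<beta>) ?p + smult 2 (pCons 0 (pderiv ?p))) j"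
    proof (cases j)
      case 0
      thus ?thesis using rG[of 0] by (simp add: coeff_ml_poly)
    next
      case (Suc k)
      show ?thesis
        unfolding Suc coeff_add coeff_smult coeff_pCons_Suc coeff_pderiv coeff_ml_poly rG[of "Suc k"]
        by (simp add: ring_distribs mult_ac)
    qed
  qed
  thus "poly (smult (of_real \<beta>) ?p + smult 2 (pCons 0 (pderiv ?p))) z = 0"
    using zero by simp
qed

text \<open>\<open>b\<close> is \<beta> raised by 0, 1 or 2 so as to fall into [2, 3]; as many Euler
  steps lead back down.\<close>

lemma ml_poly_roots:
  assumes \<beta>: "0 \<le> \<beta>" "\<beta> \<le> 3"
  obtains b where "b > 0" "\<And>n z. n > 0 \<Longrightarrow> poly (ml_poly b \<beta> n) z = 0 \<Longrightarrow> z \<in> \<real>\<^sub>\<le>\<^sub>0"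
proof -
  consider "\<beta> \<ge> 2" | "1 \<le> \<beta>" "\<beta> \<le> 2" | "\<beta> \<le> 1" by linarith
  thus ?thesis
  proof cases
    case 1
    thus ?thesis using ml_poly_roots_base[of \<beta>] \<beta> by (intro that[of \<beta>]) auto
  next
    case 2
    show ?thesis
    proof (rule that[of "\<beta> + 1"])
      fix n z assume "n > 0" "poly (ml_poly (\<beta> + 1) \<beta> n) z = 0"
      thus "z \<in> \<real>\<^sub>\<le>\<^sub>0"
        using ml_poly_roots_base[of "\<beta> + 1" n] \<beta> 2 ml_poly_roots_step[of "\<beta> + 1" \<beta> n z] by simp
    qed (use \<beta> in auto)
  next
    case 3
    have base: "z \<in> \<real>\<^sub>\<le>\<^sub>0" if "n > 0" "poly (ml_poly (\<beta> + 2) (\<beta> + 2) n) z = 0" for n z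
      using \<beta> 3 that by (intro ml_poly_roots_base[of "\<beta> + 2" n z]) auto
    have eq: "\<beta> + 1 + 1 = \<beta> + 2" by simp
    have step: "z \<in> \<real>\<^sub>\<le>\<^sub>0" if "n > 0" "poly (ml_poly (\<beta> + 2) (\<beta> + 1) n) z = 0" for n z
      by (rule ml_poly_roots_step[OF _ _ that(1) _ that(2), unfolded eq]) (use \<beta> base that(1) in auto)
    show ?thesis
    proof (rule that[of "\<beta> + 2"])
      fix n z assume n: "n > 0" and z: "poly (ml_poly (\<beta> + 2) \<beta> n) z = 0"
      show "z \<in> \<real>\<^sub>\<le>\<^sub>0"
        by (rule ml_poly_roots_step[OF _ _ n _ z]) (use \<beta> step n in auto)
    qed (use \<beta> in auto)
  qed
qed

lemma norm_mittag_leffler_2_mono_Im: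
  assumes \<beta>: "0 \<le> \<beta>" "\<beta> \<le> 3" and z: "Re z = Re z'" "\<bar>Im z\<bar> \<le> \<bar>Im z'\<bar>"
  shows "norm (mittag_leffler 2 \<beta> z) \<le> norm (mittag_leffler 2 \<beta> z')"
proof -
  obtain b where b: "b > 0" "\<And>n z. n > 0 \<Longrightarrow> poly (ml_poly b \<beta> n) z = 0 \<Longrightarrow> z \<in> \<real>\<^sub>\<le>\<^sub>0"
    using ml_poly_roots[OF \<beta>] by metis
  have "\<forall>\<^sub>F n in sequentially. norm (poly (ml_poly b \<beta> n) z) \<le> norm (poly (ml_poly b \<beta> n) z')"
    using eventually_gt_at_top[of 0]
  proof eventually_elim
    case (elim n)
    show ?case
      using b(2)[OF elim] nonpos_Reals_subset_Reals by (intro norm_poly_mono_Im z) auto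
  qed
  thus ?thesis
    by (rule tendsto_le[OF _ tendsto_norm[OF ml_poly_tendsto[OF b(1)]] tendsto_norm[OF ml_poly_tendsto[OF b(1)]], rotated]) auto
qed

text \<open>By monotonicity a nonreal zero \<open>z\<close> forces zeros on the whole segment from
  \<open>z\<close> to \<open>cnj z\<close>, so the function would vanish identically, although it is
  positive at 1.\<close>

lemma mittag_leffler_2_zero_imp_real:
  assumes \<beta>: "0 \<le> \<beta>" "\<beta> \<le> 3" and zero: "mittag_leffler 2 \<beta> z = 0"
  shows "z \<in> \<real>"
proof (rule ccontr)
  assume "z \<notin> \<real>"
  hence Im: "Im z \<noteq> 0" by (simp add: complex_is_Real_iff)
  have "mittag_leffler 2 \<beta> 1 = 0"
  proof (rule analytic_continuation[where f = "mittag_leffler 2 \<beta>" and w = 1 and S = UNIV and U = "closed_segment z (cnj z)" and \<xi> = z])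
    have "z \<noteq> cnj z" using Im by (auto simp: complex_eq_iff)
    hence "\<nexists>x. closed_segment z (cnj z) = {x}"
      by (metis ends_in_segment singletonD)
    thus "z islimpt closed_segment z (cnj z)"
      by (intro connected_imp_perfect) auto
    fix w assume "w \<in> closed_segment z (cnj z)"
    then obtain u where u: "0 \<le> u" "u \<le> 1" "w = (1 - u) *\<^sub>R z + u *\<^sub>R cnj z"
      by (auto simp: in_segment)
    have "Re w = Re z" "Im w = (1 - 2 * u) * Im z" by (simp_all add: u(3) algebra_simps)
    moreover have "\<bar>1 - 2 * u\<bar> * \<bar>Im z\<bar> \<le> \<bar>Im z\<bar>"
      using u by (intro mult_left_le_one_le) auto
    ultimately have "norm (mittag_leffler 2 \<beta> w) \<le> norm (mittag_leffler 2 \<beta> z)"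
      by (intro norm_mittag_leffler_2_mono_Im \<beta>) (auto simp: abs_mult)
    thus "mittag_leffler 2 \<beta> w = 0" using zero by simp
  qed (auto intro: mittag_leffler_2_holomorphic)
  moreover have "mittag_leffler 2 \<beta> 1 = of_real (ml_real \<beta> 1)"
    using mittag_leffler_2_of_real'[of \<beta> 1] by simp
  ultimately show False using ml_real_pos[of \<beta> 1] \<beta> by simp
qed

section \<open>The range beyond 3\<close>

lemma one_minus_cos_sums:
  fixes w :: real
  assumes "w \<noteq> 0"
  shows "(\<lambda>k. (-(w\<^sup>2)) ^ k * t ^ (2 * k + 2) / fact (2 * k + 2)) sums ((1 - cos (w * t)) / w\<^sup>2)"
proof -
  have "(\<lambda>k. (- 1) ^ Suc k / fact (2 * Suc k) * (w * t) ^ (2 * Suc k)) sums (cos (w * t) - 1)"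
    using cos_paired[of "w * t"] by (subst sums_Suc_iff) simp
  hence "(\<lambda>k. -1 / w\<^sup>2 * ((- 1) ^ Suc k / fact (2 * Suc k) * (w * t) ^ (2 * Suc k)))
           sums (-1 / w\<^sup>2 * (cos (w * t) - 1))"
    by (rule sums_mult)
  also have "-1 / w\<^sup>2 * (cos (w * t) - 1) = (1 - cos (w * t)) / w\<^sup>2"
    using assms by (simp add: field_simps)
  also have "(\<lambda>k. -1 / w\<^sup>2 * ((- 1) ^ Suc k / fact (2 * Suc k) * (w * t) ^ (2 * Suc k)))
      = (\<lambda>k. (-(w\<^sup>2)) ^ k * t ^ (2 * k + 2) / fact (2 * k + 2))"
  proof
    fix k
    have "(-(w\<^sup>2)) ^ k = (-1) ^ k * w ^ (2 * k)"
      by (simp add: power_minus[of "w\<^sup>2"] power_mult)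
    thus "-1 / w\<^sup>2 * ((- 1) ^ Suc k / fact (2 * Suc k) * (w * t) ^ (2 * Suc k))
      = (-(w\<^sup>2)) ^ k * t ^ (2 * k + 2) / fact (2 * k + 2)"
      using assms by (simp add: power_mult_distrib power2_eq_square del: fact_Suc)
  qed
  finally show ?thesis .
qed

text \<open>Expand the cosine and integrate termwise: the Beta integral of
  \<open>t^(2 * k + 2) * (1 - t) powr (\<beta> - 4)\<close> is \<open>fact (2 * k + 2) * Gamma
  (\<beta> - 3) * rGamma (2 * k + \<beta>)\<close>, and the factorial cancels.\<close>

lemma ml_real_integral:
  assumes \<beta>: "\<beta> > 3" and w: "w \<noteq> 0"
  defines "G \<equiv> \<lambda>t. (1 - t) powr (\<beta> - 4) * ((1 - cos (w * t)) / w\<^sup>2)"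
  shows "G integrable_on {0..1}" "integral {0..1} G = Gamma (\<beta> - 3) * ml_real \<beta> (-(w\<^sup>2))"
proof -
  define x where "x = -(w\<^sup>2)"
  define h where "h = (\<lambda>k t. x ^ k / fact (2 * k + 2) * (t powr (2 * real k + 2) * (1 - t) powr (\<beta> - 4)))"
  define C where "C = (\<Sum>k. \<bar>x\<bar> ^ k / fact (2 * k + 2))"
  have C: "summable (\<lambda>k. \<bar>x\<bar> ^ k / fact (2 * k + 2))"
  proof (rule summable_comparison_test)
    have "fact k \<le> (fact (2 * k + 2) :: real)" for k
      by (intro fact_mono) auto
    thus "\<exists>N. \<forall>k\<ge>N. norm (\<bar>x\<bar> ^ k / fact (2 * k + 2)) \<le> inverse (fact k) * \<bar>x\<bar> ^ k"
      by (intro exI[of _ 0]) (auto simp: divide_simps mult_left_mono simp del: fact_Suc)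
  qed (rule summable_exp)
  have h: "(h k has_integral Gamma (\<beta> - 3) * (x ^ k * rGamma (2 * real k + \<beta>))) {0..1}" for k
  proof -
    have "((\<lambda>t. t powr (2 * real k + 3 - 1) * (1 - t) powr (\<beta> - 3 - 1)) has_integral
            Beta (2 * real k + 3) (\<beta> - 3)) {0..1}"
      using \<beta> by (intro has_integral_Beta_real) auto
    hence "(h k has_integral x ^ k / fact (2 * k + 2) * Beta (2 * real k + 3) (\<beta> - 3)) {0..1}"
      unfolding h_def by (intro has_integral_mult_right) (simp add: algebra_simps)
    moreover have "Gamma (2 * real k + 3) = fact (2 * k + 2)"
      using Gamma_fact[of "2 * k + 2", where 'a = real] by (simp add: add_ac del: fact_Suc)
    hence "x ^ k / fact (2 * k + 2) * Beta (2 * real k + 3) (\<beta> - 3)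
        = Gamma (\<beta> - 3) * (x ^ k * rGamma (2 * real k + \<beta>))"
      by (simp add: Beta_def rGamma_inverse_Gamma field_simps del: fact_Suc)
    ultimately show ?thesis by simp
  qed
  have int: "(\<lambda>t. \<Sum>k<K. h k t) integrable_on {0..1}" for K
    using h by (intro integrable_sum) (auto intro: has_integral_integrable)
  \<comment> \<open>For \<open>\<beta> < 4\<close> the weight is unbounded near
    \<open>t = 1\<close>, hence dominated convergence; the majorant is integrable because
    \<open>\<beta> - 3 > 0\<close>.\<close>
  have dom: "(\<lambda>t. C * (t powr 2 * (1 - t) powr (\<beta> - 4))) integrable_on {0..1}"
    using integrable_Beta'[of 3 "\<beta> - 3"] \<beta> by (intro integrable_on_mult_right) simp
  have le: "norm (\<Sum>k<K. h k t) \<le> C * (t powr 2 * (1 - t) powr (\<beta> - 4))" if t: "t \<in> {0..1}" for K t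
  proof -
    have "norm (\<Sum>k<K. h k t) \<le> (\<Sum>k<K. \<bar>x\<bar> ^ k / fact (2 * k + 2) * (t powr 2 * (1 - t) powr (\<beta> - 4)))"
    proof (rule sum_norm_le)
      fix k
      have "t powr (2 * real k + 2) \<le> t powr 2"
      proof (cases "t = 0")
        case False
        thus ?thesis using t by (intro powr_mono') auto
      qed simp
      thus "norm (h k t) \<le> \<bar>x\<bar> ^ k / fact (2 * k + 2) * (t powr 2 * (1 - t) powr (\<beta> - 4))"
        unfolding h_def by (simp add: abs_mult power_abs mult_left_mono mult_right_mono divide_right_mono del: fact_Suc)
    qed
    also have "\<dots> = (\<Sum>k<K. \<bar>x\<bar> ^ k / fact (2 * k + 2)) * (t powr 2 * (1 - t) powr (\<beta> - 4))"
      by (simp add: sum_distrib_right)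
    also have "\<dots> \<le> C * (t powr 2 * (1 - t) powr (\<beta> - 4))"
      unfolding C_def by (intro mult_right_mono sum_le_suminf C) auto
    finally show ?thesis .
  qed
  have conv: "(\<lambda>K. \<Sum>k<K. h k t) \<longlonglongrightarrow> G t" if t: "t \<in> {0..1}" for t
  proof -
    have "t powr (2 * real k + 2) = t ^ (2 * k + 2)" for k
      using t powr_realpow[of t "2 * k + 2"] by (cases "t = 0") (auto simp: add_ac)
    hence "(\<lambda>k. h k t) = (\<lambda>k. (1 - t) powr (\<beta> - 4) * (x ^ k * t ^ (2 * k + 2) / fact (2 * k + 2)))"
      by (simp add: h_def fun_eq_iff del: fact_Suc power_Suc)
    moreover have "\<dots> sums G t"
      unfolding G_def x_def by (intro sums_mult one_minus_cos_sums w)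
    ultimately have "(\<lambda>k. h k t) sums G t" by (simp only:)
    thus ?thesis by (simp add: sums_def)
  qed
  show "G integrable_on {0..1}"
    by (rule dominated_convergence(1)[OF int dom le conv])
  have "(\<lambda>K. integral {0..1} (\<lambda>t. \<Sum>k<K. h k t)) \<longlonglongrightarrow> integral {0..1} G"
    by (rule dominated_convergence(2)[OF int dom le conv])
  moreover have "integral {0..1} (\<lambda>t. \<Sum>k<K. h k t)
      = Gamma (\<beta> - 3) * (\<Sum>k<K. x ^ k * rGamma (2 * real k + \<beta>))" for K
    unfolding sum_distrib_left by (intro integral_unique has_integral_sum h) auto
  moreover have "(\<lambda>K. Gamma (\<beta> - 3) * (\<Sum>k<K. x ^ k * rGamma (2 * real k + \<beta>)))
      \<longlonglongrightarrow> Gamma (\<beta> - 3) * ml_real \<beta> x"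
    unfolding ml_real_def by (intro tendsto_mult_left summable_LIMSEQ summable_ml_real)
  ultimately show "integral {0..1} G = Gamma (\<beta> - 3) * ml_real \<beta> (-(w\<^sup>2))"
    unfolding x_def by (simp add: LIMSEQ_unique)
qed

lemma ml_real_pos_gt_3:
  assumes \<beta>: "\<beta> > 3"
  shows "ml_real \<beta> x > 0"
proof (cases "x < 0")
  case True
  define w where "w = sqrt (-x)"
  have w: "w > 0" "x = -(w\<^sup>2)" using True by (simp_all add: w_def)
  define G where "G = (\<lambda>t. (1 - t) powr (\<beta> - 4) * ((1 - cos (w * t)) / w\<^sup>2))"
  have G: "G integrable_on {0..1}" "integral {0..1} G = Gamma (\<beta> - 3) * ml_real \<beta> x"
    using ml_real_integral[OF \<beta>, of w] w unfolding G_def by simp_all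
  have G0: "G t \<ge> 0" for t by (simp add: G_def)
  \<comment> \<open>Restricting to \<open>{0..1/2}\<close> avoids the possible singularity at 1; the
    rest of the integral is nonnegative.\<close>
  have cont: "continuous_on {0..1/2} G"
    unfolding G_def by (intro continuous_intros) (use w in auto)
  \<comment> \<open>This choice gives \<open>0 < w * t \<le> 1 < pi\<close>, where the cosine is
    below 1.\<close>
  define t where "t = min (1 / 2) (1 / w)"
  have t: "t > 0" "t \<le> 1 / 2" "w * t \<le> 1"
    using w by (auto simp: t_def min_def field_simps)
  have "cos (w * t) < cos 0"
    using t w pi_gt3 by (intro cos_monotone_0_pi) auto
  hence "G t > 0" using t w by (auto simp: G_def intro!: mult_pos_pos divide_pos_pos)
  hence "integral {0..1/2} G \<noteq> 0"
    using t by (subst integral_eq_0_iff[OF cont]) (auto simp: G0 intro!: bexI[of _ t])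
  moreover have "integral {0..1/2} G \<ge> 0"
    by (intro Henstock_Kurzweil_Integration.integral_nonneg integrable_continuous_interval cont G0)
  moreover have "integral {0..1/2} G \<le> integral {0..1} G"
    by (intro integral_subset_le integrable_continuous_interval cont G) (auto simp: G0)
  ultimately have "Gamma (\<beta> - 3) * ml_real \<beta> x > 0" using G(2) by linarith
  thus ?thesis by (rule zero_less_mult_pos) (use \<beta> in \<open>simp add: Gamma_real_pos\<close>)
next
  case False
  thus ?thesis
    using ml_real_pos[of \<beta> x] rGamma_real_pos[of \<beta>] \<beta> by (cases "x = 0") (auto simp: ml_real_0)
qed

section \<open>Existence of a zero\<close>

text \<open>
  Borel--Caratheodory: \<open>f\<close> has an entire logarithm, whose real part grows slower than \<open>norm z\<close>.
\<close>
lemma entire_nonzero_small_growth_const: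
  fixes f :: "complex \<Rightarrow> complex"
  assumes hol: "f holomorphic_on UNIV" and nz: "\<And>z. f z \<noteq> 0" and K: "K > 0"
    and bound: "\<And>z. norm (f z) \<le> K * exp (sqrt (norm z))"
  shows "f z = f 0"
proof -
  obtain g where g: "g holomorphic_on UNIV" "\<And>z. exp (g z) = f z"
    using holomorphic_logarithm_exists[of UNIV f 0] hol nz by auto
  \<comment> \<open>Subtracting \<open>g 0\<close> gives \<open>G 0 = 0\<close>, as the Schwarz
    lemma requires; the summand 1 in \<open>C\<close> makes the next estimate strict.\<close>
  define G where "G = (\<lambda>z. g z - g 0)"
  define C where "C = \<bar>ln K - Re (g 0)\<bar> + 1"
  have ReG: "Re (G z) < sqrt (norm z) + C" for z
  proof -
    have "exp (Re (g z)) \<le> exp (ln K + sqrt (norm z))"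
      using bound[of z] K by (simp add: exp_add flip: g(2))
    thus ?thesis by (simp add: G_def C_def)
  qed
  have main: "norm (G z) \<le> norm z / R * (2 * (sqrt R + C) + norm (G z))" if R: "R > norm z" for R
  proof -
    have R0: "R > 0" using R norm_ge_zero[of z] by linarith
    define A where "A = sqrt R + C"
    \<comment> \<open>The map \<open>v / (2 * A - v)\<close> sends the half-plane
      \<open>Re v < A\<close> into the unit disc and fixes 0.\<close>
    define h where "h = (\<lambda>\<zeta>. G (of_real R * \<zeta>) / (of_real (2 * A) - G (of_real R * \<zeta>)))"
    have ReA: "Re (G (of_real R * \<zeta>)) < A" if "norm \<zeta> < 1" for \<zeta>
    proof -
      have "norm (of_real R * \<zeta>) \<le> R" using that R0 by (simp add: norm_mult mult_left_le)
      hence "sqrt (norm (of_real R * \<zeta>)) \<le> sqrt R" by simp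
      thus ?thesis using ReG[of "of_real R * \<zeta>"] unfolding A_def by linarith
    qed
    have A: "A > 0" using R0 by (simp add: A_def C_def add_nonneg_pos)
    have den: "norm (G (of_real R * \<zeta>)) < norm (of_real (2 * A) - G (of_real R * \<zeta>))"
      if "norm \<zeta> < 1" for \<zeta>
    proof (rule power2_less_imp_less)
      let ?v = "G (of_real R * \<zeta>)"
      have "(norm (of_real (2 * A) - ?v))\<^sup>2 - (norm ?v)\<^sup>2 = 4 * A * (A - Re ?v)"
        by (simp add: cmod_power2) (simp add: power2_eq_square algebra_simps)
      moreover have "4 * A * (A - Re ?v) > 0" using A ReA[OF that] by simp
      ultimately show "(norm ?v)\<^sup>2 < (norm (of_real (2 * A) - ?v))\<^sup>2" by linarith
    qed auto
    have den0: "of_real (2 * A) - G (of_real R * \<zeta>) \<noteq> 0" if "norm \<zeta> < 1" for \<zeta>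
      using den[OF that] norm_ge_zero[of "G (of_real R * \<zeta>)"] by (metis norm_zero not_less)
    have Ghol: "(\<lambda>\<zeta>. G (of_real R * \<zeta>)) holomorphic_on ball 0 1"
      unfolding G_def using holomorphic_on_compose_gen[of "\<lambda>\<zeta>. of_real R * \<zeta>" "ball 0 1" g UNIV] g(1)
      by (auto simp: o_def intro!: holomorphic_intros)
    have "norm (h (z / of_real R)) \<le> norm (z / of_real R)"
    proof (rule Schwarz_Lemma(1))
      show "h holomorphic_on ball 0 1"
        unfolding h_def using den0 by (intro holomorphic_intros Ghol) auto
      show "h 0 = 0" by (simp add: h_def G_def)
      show "norm (h \<zeta>) < 1" if "norm \<zeta> < 1" for \<zeta>
      proof -
        have "norm (of_real (2 * A) - G (of_real R * \<zeta>)) > 0" using den0[OF that] by simp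
        thus ?thesis using den[OF that] by (simp add: h_def norm_divide)
      qed
      show "norm (z / of_real R) < 1" using R R0 by (simp add: norm_divide)
    qed
    moreover have zR: "norm (z / of_real R) = norm z / R" using R0 by (simp add: norm_divide)
    moreover have "h (z / of_real R) = G z / (of_real (2 * A) - G z)"
      unfolding h_def using R0 by simp
    ultimately have "norm (G z) / norm (of_real (2 * A) - G z) \<le> norm z / R"
      by (simp only: norm_divide)
    moreover have "norm (of_real (2 * A) - G z) > 0"
      using den0[of "z / of_real R"] zR R R0 by simp
    ultimately have "norm (G z) \<le> norm z / R * norm (of_real (2 * A) - G z)"
      by (simp add: pos_divide_le_eq)
    also have "\<dots> \<le> norm z / R * (2 * A + norm (G z))"
      using norm_triangle_ineq4[of "of_real (2 * A)" "G z"] A R0 by (intro mult_left_mono) auto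
    finally show ?thesis by (simp only: A_def)
  qed
  \<comment> \<open>\<open>z\<close> stays fixed while \<open>R\<close> grows;
    \<open>sqrt R / R\<close> tends to 0.\<close>
  have "((\<lambda>R. norm z / R * (2 * (sqrt R + C) + norm (G z))) \<longlongrightarrow> 0) at_top"
    by real_asymp
  moreover have "\<forall>\<^sub>F R in at_top. norm (G z) \<le> norm z / R * (2 * (sqrt R + C) + norm (G z))"
    using eventually_gt_at_top[of "norm z"] by eventually_elim (rule main)
  ultimately have "norm (G z) \<le> 0"
    by (intro tendsto_lowerbound) auto
  thus ?thesis using g(2) by (metis G_def eq_iff_diff_eq_0 norm_le_zero_iff)
qed

text \<open>For \<open>\<beta> \<ge> 1\<close>, each factor \<open>\<beta> + i\<close> of the
  Pochhammer symbol is at least the factor \<open>1 + i\<close> of the factorial.\<close>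

lemma rGamma_le_over_fact:
  assumes "\<beta> \<ge> 1"
  shows "rGamma (real m + \<beta>) \<le> rGamma \<beta> / fact m"
proof -
  have "fact m = (\<Prod>i<m. 1 + real i)"
    by (simp add: pochhammer_fact pochhammer_prod atLeast0LessThan)
  also have "\<dots> \<le> (\<Prod>i<m. \<beta> + real i)" using assms by (intro prod_mono) auto
  also have "\<dots> = pochhammer \<beta> m" by (simp add: pochhammer_prod atLeast0LessThan)
  finally have "fact m * rGamma (real m + \<beta>) \<le> pochhammer \<beta> m * rGamma (real m + \<beta>)"
    using assms by (intro mult_right_mono rGamma_real_nonneg) auto
  also have "\<dots> = rGamma \<beta>" using pochhammer_rGamma[of \<beta> m] by (simp add: add.commute)
  finally show ?thesis by (simp add: field_simps)
qed

text \<open>Termwise comparison with the even part of the exponential series at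
  \<open>sqrt (norm z)\<close>.\<close>

lemma norm_mittag_leffler_2_le:
  assumes \<beta>: "\<beta> \<ge> 1"
  shows "norm (mittag_leffler 2 \<beta> z) \<le> rGamma \<beta> * exp (sqrt (norm z))"
proof -
  define s where "s = sqrt (norm z)"
  have s: "s \<ge> 0" "s\<^sup>2 = norm z" by (simp_all add: s_def)
  define c where "c = (\<lambda>k. s ^ (2 * k) / fact (2 * k))"
  have c_bound: "(\<Sum>k<n. c k) \<le> exp s" for n
  proof -
    have "(\<Sum>k<n. c k) = (\<Sum>m\<in>(*) 2 ` {..<n}. s ^ m / fact m)"
      by (subst sum.reindex) (auto simp: c_def inj_on_def)
    also have "\<dots> \<le> (\<Sum>m<2 * n. s ^ m / fact m)"
      using s by (intro sum_mono2) auto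
    also have "\<dots> \<le> exp s"
      using s sum_le_suminf[OF summable_exp_generic[of s], of "{..<2 * n}"]
      by (simp add: exp_def divide_inverse mult.commute)
    finally show ?thesis .
  qed
  have c_nonneg: "c k \<ge> 0" for k using s by (simp add: c_def)
  have c_sum: "summable c"
    by (rule summableI_nonneg_bounded[OF c_nonneg c_bound])
  have "norm (mittag_leffler 2 \<beta> z) \<le> (\<Sum>k. rGamma \<beta> * c k)"
    unfolding mittag_leffler_def
  proof (rule norm_suminf_le)
    show "norm (z ^ k * rGamma (complex_of_real (2 * real k + \<beta>))) \<le> rGamma \<beta> * c k" for k
    proof -
      have "norm (z ^ k * rGamma (complex_of_real (2 * real k + \<beta>)))
          = norm z ^ k * rGamma (real (2 * k) + \<beta>)"
        unfolding rGamma_complex_of_real using \<beta> by (simp add: norm_mult norm_power rGamma_real_nonneg)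
      also have "\<dots> \<le> norm z ^ k * (rGamma \<beta> / fact (2 * k))"
        using \<beta> by (intro mult_left_mono rGamma_le_over_fact) auto
      also have "\<dots> = rGamma \<beta> * c k"
        unfolding c_def power_mult s(2) by simp
      finally show ?thesis .
    qed
  qed (intro summable_mult c_sum)
  also have "\<dots> = rGamma \<beta> * (\<Sum>k. c k)" by (rule suminf_mult[OF c_sum])
  also have "\<dots> \<le> rGamma \<beta> * exp s"
    using \<beta> by (intro mult_left_mono suminf_le_const c_sum c_bound rGamma_real_nonneg) auto
  finally show ?thesis by (simp add: s_def)
qed

text \<open>Without zeros the growth bound would make the function constant, but it increases
  strictly from 0 to 1.\<close>

lemma mittag_leffler_2_has_zero:
  assumes "\<beta> \<ge> 1"
  obtains z where "mittag_leffler 2 \<beta> z = 0"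
proof (rule ccontr)
  assume "\<not> thesis"
  hence "mittag_leffler 2 \<beta> z \<noteq> 0" for z using that by blast
  hence "mittag_leffler 2 \<beta> (of_real 1) = mittag_leffler 2 \<beta> 0"
    using assms by (intro entire_nonzero_small_growth_const[of _ "rGamma \<beta>"]
        mittag_leffler_2_holomorphic norm_mittag_leffler_2_le rGamma_real_pos) auto
  also have "\<dots> = mittag_leffler 2 \<beta> (of_real 0)" by simp
  finally have "ml_real \<beta> 1 = ml_real \<beta> 0"
    unfolding mittag_leffler_2_of_real' by simp
  thus False using ml_real_less[of \<beta> 0 1] assms by simp
qed

(* At \<beta> = 0 the origin is a zero, because 1 / Gamma 0 = 0; it is the only
   exception admitted to strict negativity. *)
theorem mainTheorem9:
  fixes \<beta> :: real
  assumes "\<beta> \<ge> 0"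
  shows "((\<forall>z. norm (mittag_leffler 2 \<beta> z) \<ge> Re (mittag_leffler 2 \<beta> (complex_of_real (Re z))))
            \<longleftrightarrow> (\<forall>z. mittag_leffler 2 \<beta> z = 0 \<longrightarrow>
                   z \<in> \<real> \<and> (Re z < 0 \<or> (\<beta> = 0 \<and> z = 0))))
       \<and> ((\<forall>z. mittag_leffler 2 \<beta> z = 0 \<longrightarrow>
                   z \<in> \<real> \<and> (Re z < 0 \<or> (\<beta> = 0 \<and> z = 0)))
            \<longleftrightarrow> \<beta> \<le> 3)"
proof (cases "\<beta> \<le> 3")
  case True
  have "norm (mittag_leffler 2 \<beta> z) \<ge> Re (mittag_leffler 2 \<beta> (complex_of_real (Re z)))" for z
  proof -
    have "Re (mittag_leffler 2 \<beta> (complex_of_real (Re z))) \<le> norm (mittag_leffler 2 \<beta> (of_real (Re z)))"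
      by (rule complex_Re_le_cmod)
    also have "\<dots> \<le> norm (mittag_leffler 2 \<beta> z)"
      by (rule norm_mittag_leffler_2_mono_Im[OF assms True]) auto
    finally show ?thesis .
  qed
  moreover have "z \<in> \<real> \<and> (Re z < 0 \<or> (\<beta> = 0 \<and> z = 0))" if zero: "mittag_leffler 2 \<beta> z = 0" for z
  proof -
    have real: "z \<in> \<real>" by (rule mittag_leffler_2_zero_imp_real[OF assms True zero])
    then obtain x where x: "z = of_real x" by (elim Reals_cases)
    have "ml_real \<beta> x = 0" using zero unfolding x mittag_leffler_2_of_real' by simp
    hence "x < 0 \<or> x = 0 \<and> \<beta> = 0"
      using ml_real_pos[OF assms, of x] ml_real_0[of \<beta>] rGamma_real_pos[of \<beta>] assms
      by (metis less_irrefl linorder_cases order_le_less)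
    thus ?thesis using real x by auto
  qed
  ultimately show ?thesis using True by blast
next
  case False
  hence \<beta>: "\<beta> > 3" by simp
  obtain z where z: "mittag_leffler 2 \<beta> z = 0"
    using mittag_leffler_2_has_zero[of \<beta>] \<beta> by auto
  have pos: "Re (mittag_leffler 2 \<beta> (of_real x)) > 0" for x
    unfolding mittag_leffler_2_of_real' using ml_real_pos_gt_3[OF \<beta>] by simp
  \<comment> \<open>One zero refutes both conditions: by positivity it is nonreal, and the norm
    there is 0 while the value at \<open>Re z\<close> is positive.\<close>
  have "z \<notin> \<real>"
    using pos z by (metis Reals_cases less_irrefl zero_complex.simps(1))
  moreover have "\<not> norm (mittag_leffler 2 \<beta> z) \<ge> Re (mittag_leffler 2 \<beta> (complex_of_real (Re z)))"
    using pos[of "Re z"] z by simp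
  ultimately show ?thesis using False z by blast
qed

end
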